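(* Let $\preceq$ be a fixed monomial order on $\mathbb{N}^p$ and let $S\subseteq\mathbb{N}^p$, $S\neq\{0\}$, be a $\mathcal{C}$-semigroup. Then $G(\mathcal{J}(S))$ is a tree with root $S$. Furthermore, for every $T\in\mathcal{J}(S)$, the set of children of $T$ is $$\{T\setminus\{x\}\mid x\in imsg_S(T\setminus\{0\})\text{ and } x\succ\mathcal{O}_S(T)\},$$ where for $T=S$ the condition $x\succ\mathcal{O}_S(T)$ is regarded as always satisfied.
   Context: $\mathbb{N}$ contains $0$, and $p\ge 1$. An affine semigroup $S\subseteq\mathbb{N}^p$ is a finitely generated submonoid of $(\mathbb{N}^p,+)$ (containing $0$). For $B\subseteq\mathbb{N}^p$, $\mathcal{C}_B=\{\sum_{i=1}^k\lambda_i b_i\mid k\in\mathbb{N},\ \lambda_i\in\mathbb{Q}_{\ge 0},\ b_i\in B\}\cap\mathbb{N}^p$. An affine semigroup $S$ is a $\mathcal{C}$-semigroup if $\mathcal{C}_S\setminus S$ is finite. A monomial order on $\mathbb{N}^p$ is a total order $\preceq$ compatible with addition and with $0\preceq c$ for all $c\in\mathbb{N}^p$. An ideal of $S$ is a non-empty subset $P\subseteq S$ with $P+S\subseteq P$. An affine semigroup $T$ is an $I(S)$-semigroup if $T\setminus\{0\}$ is an ideal of $S$; $\mathcal{J}(S)$ is the set of all $I(S)$-semigroups. When $S$ is a $\mathcal{C}$-semigroup, $S\setminus T$ is finite for each $T\in\mathcal{J}(S)$, and for $T\ne S$ one puts $\mathcal{O}_S(T)=\max_\preceq(S\setminus T)$.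 A non-empty subset $X\subseteq S$ is $S$-incomparable if $x-x'\notin S$ for all distinct $x,x'\in X$; for an ideal $P$ of $S$, $imsg_S(P)$ is the unique $S$-incomparable subset $X$ of $S$ with $P=X+S$. The directed graph $G(\mathcal{J}(S))$ has vertex set $\mathcal{J}(S)$, and $(T_1,T_2)\in\mathcal{J}(S)\times\mathcal{J}(S)$ is an edge if $T_1\neq S$ and $T_2=T_1\cup\{\mathcal{O}_S(T_1)\}$; in that case $T_1$ is called a child of $T_2$. That $G(\mathcal{J}(S))$ is a tree with root $S$ means that for every vertex $T$ there is a unique (directed) path from $T$ to $S$. *)

theory Defs
  imports
    "HOL-Analysis.Finite_Cartesian_Product"
    "HOL-Library.Set_Algebras"
    "Graph_Theory.Arc_Walk"
begin

text \<open>
  \<open>\<nat>\<^sup>p\<close> is the type \<^typ>\<open>nat ^ 'p\<close>, whose index type is finite and non-empty.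
  The sum \<open>P + S\<close> of two sets is the elementwise (Minkowski) sum of \<^theory>\<open>HOL-Library.Set_Algebras\<close>.
\<close>

definition submonoid :: "'a::monoid_add set \<Rightarrow> bool" where
  "submonoid M \<longleftrightarrow> 0 \<in> M \<and> (\<forall>x\<in>M. \<forall>y\<in>M. x + y \<in> M)"

definition affine_semigroup :: "(nat ^ 'p) set \<Rightarrow> bool" where
  "affine_semigroup S \<longleftrightarrow> (\<exists>B. finite B \<and> S = submonoid hull B)"

definition rat_cone :: "(nat ^ 'p) set \<Rightarrow> (nat ^ 'p) set" where
  "rat_cone B = {x. \<exists>(k::nat) (l :: nat \<Rightarrow> rat) (b :: nat \<Rightarrow> nat ^ 'p).
     (\<forall>i<k. 0 \<le> l i \<and> b i \<in> B) \<and>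
     (\<forall>j. (of_nat (x $ j) :: rat) = (\<Sum>i<k. l i * of_nat (b i $ j)))}"

definition C_semigroup :: "(nat ^ 'p) set \<Rightarrow> bool" where
  "C_semigroup S \<longleftrightarrow> affine_semigroup S \<and> finite (rat_cone S - S)"

text \<open>The order is a parameter, unrelated to the \<open>\<le>\<close> of the type class \<^class>\<open>ord\<close>.\<close>

definition monomial_order :: "(nat ^ 'p \<Rightarrow> nat ^ 'p \<Rightarrow> bool) \<Rightarrow> bool" where
  "monomial_order le \<longleftrightarrow>
     linear_order {(a, b). le a b} \<and>
     (\<forall>a b c. le a b \<longrightarrow> le (a + c) (b + c)) \<and>
     (\<forall>c. le 0 c)"

definition ideal_of :: "(nat ^ 'p) set \<Rightarrow> (nat ^ 'p) set \<Rightarrow> bool" where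
  "ideal_of S P \<longleftrightarrow> P \<noteq> {} \<and> P \<subseteq> S \<and> P + S \<subseteq> P"

definition J :: "(nat ^ 'p) set \<Rightarrow> (nat ^ 'p) set set" where
  "J S = {T. affine_semigroup T \<and> ideal_of S (T - {0})}"

definition max_wrt :: "('a \<Rightarrow> 'a \<Rightarrow> bool) \<Rightarrow> 'a set \<Rightarrow> 'a" where
  "max_wrt le A = (THE m. m \<in> A \<and> (\<forall>a\<in>A. le a m))"

text \<open>Unspecified when \<open>T = S\<close>.\<close>

definition Omax :: "(nat ^ 'p \<Rightarrow> nat ^ 'p \<Rightarrow> bool) \<Rightarrow> (nat ^ 'p) set \<Rightarrow> (nat ^ 'p) set \<Rightarrow> nat ^ 'p" where
  "Omax le S T = max_wrt le (S - T)"

text \<open>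
  Subtraction of natural numbers truncates, so \<open>x - x' \<in> S\<close> (a difference in \<open>\<int>\<^sup>p\<close>) is
  written as \<open>x = x' + s\<close> for some \<open>s \<in> S\<close>.
\<close>

definition incomparable :: "(nat ^ 'p) set \<Rightarrow> (nat ^ 'p) set \<Rightarrow> bool" where
  "incomparable S X \<longleftrightarrow> X \<noteq> {} \<and> X \<subseteq> S \<and>
     (\<forall>x\<in>X. \<forall>x'\<in>X. x \<noteq> x' \<longrightarrow> \<not> (\<exists>s\<in>S. x = x' + s))"

definition imsg :: "(nat ^ 'p) set \<Rightarrow> (nat ^ 'p) set \<Rightarrow> (nat ^ 'p) set" where
  "imsg S P = (THE X. incomparable S X \<and> P = X + S)"

definition G_J :: "(nat ^ 'p \<Rightarrow> nat ^ 'p \<Rightarrow> bool) \<Rightarrow> (nat ^ 'p) set \<Rightarrow>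
    ((nat ^ 'p) set, (nat ^ 'p) set \<times> (nat ^ 'p) set) pre_digraph" where
  "G_J le S = \<lparr> verts = J S,
     arcs = {(T1, T2). T1 \<in> J S \<and> T2 \<in> J S \<and> T1 \<noteq> S \<and> T2 = T1 \<union> {Omax le S T1}},
     tail = fst, head = snd \<rparr>"

definition children :: "('a, 'b) pre_digraph \<Rightarrow> 'a \<Rightarrow> 'a set" where
  "children G v = {tail G e | e. e \<in> arcs G \<and> head G e = v}"

text \<open>
  Paths are directed walks without repeated arcs (\<open>trail\<close>). Unlike with paths without
  repeated vertices, uniqueness then also rules out directed cycles, for instance arcs leaving the root.
\<close>

definition tree_with_root :: "('a, 'b) pre_digraph \<Rightarrow> 'a \<Rightarrow> bool" where
  "tree_with_root G r \<longleftrightarrow> wf_digraph G \<and> r \<in> verts G \<and>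
     (\<forall>v\<in>verts G. \<exists>!w. pre_digraph.trail G v w r)"

end

theory Submission
  imports Defs
begin

text \<open>
  Every \<open>T \<in> J S\<close> has finite complement in \<open>S\<close>. Given \<open>t \<in> T - {0}\<close> and \<open>s \<in> S\<close>, all \<open>t + n s\<close>
  lie in the finitely generated \<open>T\<close>; by Dickson's lemma two of them, for \<open>i < j\<close>, have comparable
  coefficient vectors, and subtracting these gives \<open>(j - i) s \<in> T\<close>. Thus some positive multiple of
  each generator of \<open>S\<close> lies in \<open>T\<close>, which bounds the coefficients of elements outside the ideal.

  Adjoining the maximal gap keeps \<open>T\<close> in \<open>J S\<close>, since every proper \<open>S\<close>-translate of that gap is larger
  and so lies in \<open>T\<close>; hence each \<open>T \<noteq> S\<close> has exactly one outgoing arc, along which the number of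
  gaps drops. Conversely, \<open>T - {x}\<close> is in \<open>J S\<close> exactly when \<open>x\<close> is a minimal generator of the ideal.
\<close>

section \<open>Basic facts on submonoids\<close>

lemma submonoid_zero: "submonoid M \<Longrightarrow> 0 \<in> M"
  and submonoid_add: "submonoid M \<Longrightarrow> x \<in> M \<Longrightarrow> y \<in> M \<Longrightarrow> x + y \<in> M"
  by (auto simp: submonoid_def)

lemma submonoidI:
  "0 \<in> M \<Longrightarrow> (\<And>x y. x \<in> M \<Longrightarrow> y \<in> M \<Longrightarrow> x + y \<in> M) \<Longrightarrow> submonoid M"
  by (auto simp: submonoid_def)

lemma submonoid_hull_submonoid: "submonoid (submonoid hull B)"
  by (rule hull_in) (auto simp: submonoid_def)

section \<open>Dickson's lemma\<close>

text \<open>Every sequence has a monotone subsequence. A decreasing one in the naturals is constant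
  once it attains its minimum, so its tail from there is increasing as well.\<close>

lemma nat_seq_incseq_subseq:
  fixes f :: "nat \<Rightarrow> nat"
  obtains r where "strict_mono r" "incseq (f \<circ> r)"
proof -
  obtain r where r: "strict_mono r" "monoseq (f \<circ> r)"
    using seq_monosub[of f] by (auto simp: o_def)
  show thesis
  proof (cases "incseq (f \<circ> r)")
    case True
    with r show thesis using that by blast
  next
    case False
    with r have dec: "decseq (f \<circ> r)"
      by (auto simp: monoseq_iff)
    define m where "m = (LEAST y. y \<in> range (f \<circ> r))"
    have "m \<in> range (f \<circ> r)"
      unfolding m_def by (rule LeastI_ex) auto
    then obtain N where N: "m = (f \<circ> r) N" by auto
    have const: "(f \<circ> r) n = m" if "n \<ge> N" for n
    proof (rule antisym)
      show "(f \<circ> r) n \<le> m"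
        using dec that N by (simp add: decseq_def)
      show "m \<le> (f \<circ> r) n"
        unfolding m_def by (rule Least_le) auto
    qed
    have "strict_mono (\<lambda>n. r (N + n))"
      using r(1) by (simp add: strict_mono_def)
    moreover have "incseq (f \<circ> (\<lambda>n. r (N + n)))"
      using const by (simp add: incseq_def o_def)
    ultimately show thesis by (rule that)
  qed
qed

text \<open>One coordinate at a time: refining the subsequence for a new coordinate keeps
  monotonicity in the earlier ones.\<close>

lemma Dickson_subseq:
  fixes f :: "nat \<Rightarrow> 'b \<Rightarrow> nat"
  assumes "finite A"
  shows "\<exists>r. strict_mono r \<and> (\<forall>a\<in>A. incseq (\<lambda>n. f (r n) a))"
  using assms
proof induction
  case empty
  show ?case by (rule exI[of _ id]) (simp add: strict_mono_def)
next
  case (insert a A)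
  then obtain r where r: "strict_mono r" "\<forall>a\<in>A. incseq (\<lambda>n. f (r n) a)" by blast
  obtain q where q: "strict_mono q" "incseq ((\<lambda>n. f (r n) a) \<circ> q)"
    by (rule nat_seq_incseq_subseq)
  have "incseq (\<lambda>n. f (r (q n)) b)" if "b \<in> A" for b
    using r(2) that q(1) by (simp add: incseq_def strict_mono_less_eq)
  with r(1) q show ?case
    by (intro exI[of _ "r \<circ> q"]) (auto simp: strict_mono_o o_def strict_mono_def)
qed

lemma Dickson:
  fixes f :: "nat \<Rightarrow> 'b \<Rightarrow> nat"
  assumes "finite A"
  obtains i j where "i < j" "\<And>a. a \<in> A \<Longrightarrow> f i a \<le> f j a"
proof -
  obtain r where r: "strict_mono r" "\<forall>a\<in>A. incseq (\<lambda>n. f (r n) a)"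
    using Dickson_subseq[OF assms] by blast
  have "r 0 < r 1" using r(1) by (simp add: strict_mono_def)
  moreover have "f (r 0) a \<le> f (r 1) a" if "a \<in> A" for a
    using r(2) that by (simp add: incseq_def)
  ultimately show thesis by (rule that)
qed

section \<open>Finitely generated submonoids\<close>

text \<open>Multiples are written as products throughout: in \<open>nat ^ 'p\<close> multiplication
  is componentwise and \<open>of_nat n\<close> is the constant vector, so
  \<open>of_nat n * x\<close> is the \<open>n\<close>-fold sum of \<open>x\<close>.\<close>

lemma submonoid_of_nat_mult:
  fixes x :: "'a::semiring_1"
  assumes "submonoid M" "x \<in> M"
  shows "of_nat n * x \<in> M"
  using assms by (induction n) (auto simp: submonoid_def algebra_simps)

lemma submonoid_sum:
  assumes "submonoid M" "\<And>i. i \<in> I \<Longrightarrow> f i \<in> M"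
  shows "sum f I \<in> M"
  using assms(2) by (induction I rule: infinite_finite_induct)
    (use assms(1) in \<open>auto simp: submonoid_def\<close>)

lemma submonoid_hull_finite:
  fixes B :: "'a::comm_semiring_1 set"
  assumes "finite B"
  shows "submonoid hull B = {\<Sum>b\<in>B. of_nat (c b) * b | c. True}" (is "_ = ?M")
proof (rule hull_unique)
  show "B \<subseteq> ?M"
  proof
    fix x assume x: "x \<in> B"
    have "(\<Sum>b\<in>B. of_nat (if b = x then 1 else 0) * b) = (\<Sum>b\<in>B. if b = x then b else 0)"
      by (rule sum.cong) auto
    also have "\<dots> = x" using assms x by simp
    finally show "x \<in> ?M" by (auto intro!: exI[of _ "\<lambda>b. if b = x then 1 else 0"])
  qed
  show "submonoid ?M"
    unfolding submonoid_def
  proof (intro conjI ballI)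
    show "0 \<in> ?M" by (auto intro!: exI[of _ "\<lambda>b. 0"])
    fix x y assume "x \<in> ?M" "y \<in> ?M"
    then obtain c d where "x = (\<Sum>b\<in>B. of_nat (c b) * b)" "y = (\<Sum>b\<in>B. of_nat (d b) * b)"
      by auto
    then have "x + y = (\<Sum>b\<in>B. of_nat (c b + d b) * b)"
      by (simp add: sum.distrib algebra_simps)
    then show "x + y \<in> ?M" by (auto intro!: exI[of _ "\<lambda>b. c b + d b"])
  qed
  show "?M \<subseteq> N" if "B \<subseteq> N" "submonoid N" for N
    using that by (auto intro!: submonoid_sum submonoid_of_nat_mult)
qed

lemma nat_vec_add_eq_0_iff: "x + y = 0 \<longleftrightarrow> x = 0 \<and> y = (0 :: nat ^ 'p)"
  by (auto simp: vec_eq_iff)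

lemma of_nat_nth: "(of_nat n :: nat ^ 'p) $ i = n"
  by (induction n) auto

lemma affine_imp_submonoid: "affine_semigroup S \<Longrightarrow> submonoid S"
  by (auto simp: affine_semigroup_def submonoid_hull_submonoid)

section \<open>Finiteness of the complement\<close>

lemma affine_multiple_mem:
  assumes "affine_semigroup T" and "\<And>n. t + of_nat n * s \<in> T"
  obtains k where "k > 0" "of_nat k * s \<in> T"
proof -
  obtain B where B: "finite B" "T = submonoid hull B"
    using assms(1) by (auto simp: affine_semigroup_def)
  have "\<exists>c. t + of_nat n * s = (\<Sum>b\<in>B. of_nat (c b) * b)" for n
    using assms(2)[of n] B(1) by (simp add: B(2) submonoid_hull_finite)
  then obtain c where c: "\<And>n. t + of_nat n * s = (\<Sum>b\<in>B. of_nat (c n b) * b)" by metis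
  obtain i j where ij: "i < j" "\<And>b. b \<in> B \<Longrightarrow> c i b \<le> c j b"
    using Dickson[OF B(1), of c] by blast
  have "t + of_nat i * s + of_nat (j - i) * s = t + of_nat j * s"
    using ij(1) by (simp only: add.assoc flip: distrib_right of_nat_add) simp
  \<comment> \<open>The choice of \<open>i\<close> and \<open>j\<close> makes the truncated
    difference exact. Cancelling \<open>t + of_nat i * s\<close> then leaves a combination of
    \<open>B\<close> with natural coefficients.\<close>
  also have "\<dots> = (\<Sum>b\<in>B. of_nat (c i b + (c j b - c i b)) * b)"
    using ij(2) by (simp add: c)
  also have "\<dots> = t + of_nat i * s + (\<Sum>b\<in>B. of_nat (c j b - c i b) * b)"
    by (simp add: c sum.distrib distrib_right)
  finally have "of_nat (j - i) * s = (\<Sum>b\<in>B. of_nat (c j b - c i b) * b)"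
    by simp
  then have "of_nat (j - i) * s \<in> T"
    using B by (auto simp: submonoid_hull_finite)
  with ij(1) show thesis by (intro that[of "j - i"]) auto
qed

lemma ideal_add_mem: "ideal_of S P \<Longrightarrow> x \<in> P \<Longrightarrow> s \<in> S \<Longrightarrow> x + s \<in> P"
  by (auto simp: ideal_of_def set_plus_def)

text \<open>If some nonzero generator \<open>a\<close> occurred at least \<open>k a\<close> times in
  a gap, splitting off \<open>k a\<close> copies would put the gap into the ideal. Hence all gaps
  come from a finite box of coefficients.\<close>

lemma finite_complement_J:
  assumes S: "affine_semigroup S" and T: "T \<in> J S"
  shows "finite (S - T)"
proof -
  have aT: "affine_semigroup T" and idl: "ideal_of S (T - {0})"
    using T by (auto simp: J_def)
  have subS: "submonoid S" using S by (rule affine_imp_submonoid)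
  obtain t where t: "t \<in> T - {0}"
    using idl by (auto simp: ideal_of_def)
  obtain A where A: "finite A" "S = submonoid hull A"
    using S by (auto simp: affine_semigroup_def)
  have "\<exists>k>0. of_nat k * a \<in> T" if "a \<in> A" for a
  proof -
    have "a \<in> S" using that A by (simp add: hull_inc)
    then have "t + of_nat n * a \<in> T" for n
      using ideal_add_mem[OF idl t submonoid_of_nat_mult[OF subS]] by blast
    then show ?thesis using affine_multiple_mem[OF aT, of t a] by blast
  qed
  then obtain k where k: "\<And>a. a \<in> A \<Longrightarrow> k a > 0 \<and> of_nat (k a) * a \<in> T" by metis
  let ?F = "(\<lambda>c. \<Sum>a\<in>A. of_nat (c a) * a) ` (\<Pi>\<^sub>E a\<in>A. {..<k a})"
  have "S - T \<subseteq> ?F"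
  proof
    fix s assume s: "s \<in> S - T"
    then have "s \<in> {\<Sum>a\<in>A. of_nat (c a) * a | c. True}"
      using A by (simp add: submonoid_hull_finite)
    then obtain c where c: "s = (\<Sum>a\<in>A. of_nat (c a) * a)" by auto
    \<comment> \<open>The generating set may contain \<open>0\<close>, whose multiples never lie in
      \<open>T - {0}\<close>; its irrelevant coefficient is set to 0, which is below
      \<open>k 0\<close>.\<close>
    define d where "d = (\<lambda>a. if a = 0 then 0 else c a)"
    have sd: "s = (\<Sum>a\<in>A. of_nat (d a) * a)"
      unfolding c d_def by (rule sum.cong) auto
    have "d a < k a" if a: "a \<in> A" for a
    proof (rule ccontr)
      assume "\<not> d a < k a"
      then have le: "k a \<le> d a" by simp
      with k[OF a] have "a \<noteq> 0" by (auto simp: d_def)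
      \<comment> \<open>What is left of \<open>s\<close> after removing \<open>k a\<close> copies of
        \<open>a\<close>.\<close>
      let ?r = "of_nat (d a - k a) * a + (\<Sum>b\<in>A - {a}. of_nat (d b) * b)"
      have "?r \<in> S"
        using a A(2) subS
        by (auto intro!: submonoid_add submonoid_sum submonoid_of_nat_mult simp: hull_inc)
      moreover have "of_nat (k a) * a \<in> T - {0}"
        using k[OF a] \<open>a \<noteq> 0\<close> by (auto simp: vec_eq_iff of_nat_nth)
      ultimately have "of_nat (k a) * a + ?r \<in> T - {0}"
        by (intro ideal_add_mem[OF idl])
      moreover have "of_nat (k a) * a + of_nat (d a - k a) * a = of_nat (d a) * a"
        using le by (simp flip: distrib_right of_nat_add del: of_nat_diff)
      then have "of_nat (k a) * a + ?r = s"
        unfolding sd sum.remove[OF A(1) a] by (simp only: flip: add.assoc)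
      ultimately show False using s by auto
    qed
    \<comment> \<open>Members of the extensional product must be \<open>undefined\<close> outside
      \<open>A\<close>, hence \<open>restrict\<close>.\<close>
    moreover have "s = (\<Sum>a\<in>A. of_nat (restrict d A a) * a)"
      by (simp add: sd)
    ultimately show "s \<in> ?F"
      by (intro image_eqI[of _ _ "restrict d A"]) auto
  qed
  moreover have "finite ?F"
    using A(1) by (intro finite_imageI finite_PiE) auto
  ultimately show ?thesis by (rule finite_subset)
qed

section \<open>Adding or removing one element of an affine semigroup\<close>

lemma affine_semigroup_insert:
  assumes "affine_semigroup T" "submonoid (insert x T)"
  shows "affine_semigroup (insert x T)"
proof -
  obtain B where B: "finite B" "T = submonoid hull B"
    using assms(1) by (auto simp: affine_semigroup_def)
  have "submonoid hull (insert x B) = insert x T"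
  proof (rule hull_unique)
    show "insert x B \<subseteq> insert x T" using B(2) hull_subset[of B submonoid] by auto
    show "submonoid (insert x T)" by fact
    show "insert x T \<subseteq> N" if "insert x B \<subseteq> N" "submonoid N" for N
      using that B(2) hull_minimal[of B N submonoid] by auto
  qed
  with B(1) show ?thesis
    unfolding affine_semigroup_def by (metis finite.insertI)
qed

text \<open>Explicit generators for the smaller monoid: a single \<open>x\<close> in a sum is
  absorbed by another generator \<open>b\<close> through \<open>b + x\<close>, and two or more
  copies of \<open>x\<close> are made of \<open>x + x\<close> and \<open>x + x + x\<close>. Only
  \<open>x\<close> itself is lost.\<close>

lemma affine_semigroup_remove:
  assumes "affine_semigroup T" and sub: "submonoid (T - {x})" and x: "x \<in> T"
  shows "affine_semigroup (T - {x})"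
proof -
  obtain B where B: "finite B" "T = submonoid hull B"
    using assms(1) by (auto simp: affine_semigroup_def)
  have BT: "B \<subseteq> T" using B(2) hull_subset[of B submonoid] by auto
  have T: "submonoid T" using B(2) by (simp add: submonoid_hull_submonoid)
  have x0: "x \<noteq> 0" using sub by (auto simp: submonoid_def)
  let ?B = "B - {0, x}"
  let ?G = "?B \<union> (\<lambda>b. b + x) ` ?B \<union> {x + x, x + x + x}"
  let ?H = "submonoid hull ?G"
  have H: "submonoid ?H" by (rule submonoid_hull_submonoid)
  have add: "y + z \<in> ?H" if "y \<in> ?H" "z \<in> ?H" for y z
    using H that by (rule submonoid_add)
  have G: "g \<in> ?H" if "g \<in> ?G" for g using that by (rule hull_inc)
  have GT: "?G \<subseteq> T - {x}"
  proof
    fix g assume g: "g \<in> ?G"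
    then have "g \<in> T"
      using BT T x by (auto simp: submonoid_def)
    \<comment> \<open>By cancellation, \<open>b + x = x\<close> would give \<open>b = 0\<close>, and
      the multiples of \<open>x\<close> in \<open>?G\<close> would give
      \<open>x = 0\<close>.\<close>
    moreover have "g \<noteq> x"
      using g x0 by (auto simp: nat_vec_add_eq_0_iff add.assoc)
    ultimately show "g \<in> T - {x}" by simp
  qed
  have shift: "x + g \<in> insert x ?H" if "g \<in> ?H" for g
  proof -
    \<comment> \<open>Induction over the hull: \<open>?K\<close> contains the generators and is a
      submonoid. The value \<open>x\<close> must be allowed because of \<open>g = 0\<close>.\<close>
    have "?H \<subseteq> {g \<in> ?H. x + g \<in> insert x ?H}" (is "_ \<subseteq> ?K")
    proof (rule hull_minimal)
      show "?G \<subseteq> ?K"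
      proof
        fix g assume g: "g \<in> ?G"
        consider "g \<in> ?B" | b where "b \<in> ?B" "g = b + x" | "g = x + x" | "g = x + x + x"
          using g by blast
        then have "x + g \<in> ?H"
        proof cases
          case 1
          then show ?thesis by (intro G) (auto simp: add.commute)
        next
          case 2
          then have "b + (x + x) \<in> ?H" by (intro add G) auto
          with 2 show ?thesis by (simp add: algebra_simps)
        next
          case 3
          then show ?thesis by (intro G) (auto simp: add.assoc)
        next
          case 4
          have "(x + x) + (x + x) \<in> ?H" by (intro add G) auto
          with 4 show ?thesis by (simp add: algebra_simps)
        qed
        with G[OF g] show "g \<in> ?K" by simp
      qed
      show "submonoid ?K"
      proof (rule submonoidI)
        show "0 \<in> ?K" using submonoid_zero[OF H] by simp
        fix y z assume y: "y \<in> ?K" and z: "z \<in> ?K"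
        \<comment> \<open>The summand \<open>x\<close> is absorbed by \<open>y\<close>, unless
          \<open>y = 0\<close>; then \<open>z\<close> takes its place.\<close>
        have "x + (y + z) \<in> insert x ?H"
        proof (cases "x + y = x")
          case True
          then have "y = 0" by simp
          with z show ?thesis by simp
        next
          case False
          with y z have "(x + y) + z \<in> ?H" by (intro add[of "x + y" z]) auto
          then show ?thesis by (simp add: add.assoc)
        qed
        with y z add show "y + z \<in> ?K" by simp
      qed
    qed
    with that show ?thesis by blast
  qed
  have "T \<subseteq> insert x ?H"
    unfolding B(2)
  proof (rule hull_minimal)
    have 0: "0 \<in> ?H" using H by (rule submonoid_zero)
    show "B \<subseteq> insert x ?H"
      using G 0 by auto
    have xx: "x + x \<in> ?H" by (rule G) simp
    show "submonoid (insert x ?H)"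
    proof (rule submonoidI)
      fix y z assume y: "y \<in> insert x ?H" and z: "z \<in> insert x ?H"
      consider "y = x" "z = x" | "y = x" "z \<in> ?H" | "y \<in> ?H" "z = x" | "y \<in> ?H" "z \<in> ?H"
        using y z by blast
      then show "y + z \<in> insert x ?H"
      proof cases
        case 1
        with xx show ?thesis by simp
      next
        case 2
        with shift show ?thesis by simp
      next
        case 3
        with shift[of y] show ?thesis by (simp only: add.commute[of y])
      next
        case 4
        with add show ?thesis by simp
      qed
    qed (use 0 in simp)
  qed
  moreover have "?H \<subseteq> T - {x}"
    using GT sub by (rule hull_minimal)
  ultimately have "T - {x} = ?H" by auto
  moreover have "finite ?G" using B(1) by simp
  ultimately show ?thesis unfolding affine_semigroup_def by (intro exI[of _ ?G] conjI)
qed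

section \<open>Minimal generators of an ideal\<close>

text \<open>Descent on the coordinate sum shows that the irreducible elements generate
  \<open>P\<close>. Any other incomparable generating set equals them, since sums in
  \<open>nat ^ 'p\<close> vanish only if all summands do. Later proofs use this form instead of the
  definite description.\<close>

lemma imsg_eq:
  assumes S: "submonoid S" and P: "ideal_of S P"
  shows "imsg S P = {x \<in> P. \<not> (\<exists>y\<in>P. \<exists>s\<in>S - {0}. x = y + s)}" (is "_ = ?M")
proof -
  have S0: "0 \<in> S" and Sadd: "\<And>x y. x \<in> S \<Longrightarrow> y \<in> S \<Longrightarrow> x + y \<in> S"
    using S by (auto simp: submonoid_def)
  have PS: "P \<subseteq> S" using P by (simp add: ideal_of_def)
  have gen: "y \<in> ?M + S" if "y \<in> P" for y
    using that
  proof (induction "\<Sum>i\<in>UNIV. y $ i" arbitrary: y rule: less_induct)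
    case less
    show ?case
    proof (cases "y \<in> ?M")
      case True
      from this S0 have "y + 0 \<in> ?M + S" by (rule set_plus_intro)
      then show ?thesis by simp
    next
      case False
      with less.prems obtain z s where zs: "z \<in> P" "s \<in> S" "s \<noteq> 0" "y = z + s" by auto
      obtain i where "s $ i \<noteq> 0" using zs(3) by (auto simp: vec_eq_iff)
      \<comment> \<open>Removing the nonzero \<open>s\<close> strictly lowers the coordinate
        sum.\<close>
      then have "(\<Sum>i\<in>UNIV. z $ i) < (\<Sum>i\<in>UNIV. y $ i)"
        unfolding zs(4) by (intro sum_strict_mono_ex1) (auto intro!: exI[of _ i])
      from less.hyps[OF this zs(1)] obtain m s' where "m \<in> ?M" "s' \<in> S" "z = m + s'"
        by (auto simp: set_plus_def)
      then have "m + (s' + s) \<in> ?M + S"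
        using zs(2) Sadd by (intro set_plus_intro) auto
      then show ?thesis using \<open>z = m + s'\<close> zs(4) by (simp add: add.assoc)
    qed
  qed
  show ?thesis
    unfolding imsg_def
  proof (rule the_equality)
    obtain y where "y \<in> P" using P by (auto simp: ideal_of_def)
    from gen[OF this] have "?M \<noteq> {}" by (auto elim: set_plus_elim)
    moreover have False if "x \<in> ?M" "x' \<in> ?M" "x \<noteq> x'" "s \<in> S" "x = x' + s" for x x' s
      using that by (cases "s = 0") auto
    ultimately have "incomparable S ?M"
      using PS unfolding incomparable_def by blast
    moreover have "?M + S \<subseteq> P"
      using ideal_add_mem[OF P] by (auto simp: set_plus_def)
    ultimately show "incomparable S ?M \<and> P = ?M + S" using gen by blast
  next
    fix X assume "incomparable S X \<and> P = X + S"
    then have X: "incomparable S X" and PX: "P = X + S" by auto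
    have XP: "x \<in> P" if "x \<in> X" for x
      unfolding PX using set_plus_intro[OF that S0] by simp
    show "X = ?M"
    proof (intro equalityI subsetI)
      fix x assume x: "x \<in> X"
      have False if "y \<in> P" "s \<in> S" "s \<noteq> 0" "x = y + s" for y s
      proof -
        obtain x' s' where "x' \<in> X" "s' \<in> S" "y = x' + s'"
          using \<open>y \<in> P\<close> unfolding PX by (auto simp: set_plus_def)
        then have eq: "x = x' + (s' + s)" "s' + s \<in> S" "x' \<in> X"
          using that Sadd by (auto simp: add.assoc)
        \<comment> \<open>Incomparability of \<open>X\<close> forces equality; cancellation then
          gives \<open>s' + s = 0\<close>, contradicting \<open>s \<noteq> 0\<close>.\<close>
        with X x have "x = x'" unfolding incomparable_def by blast
        with eq(1) have "s' + s = 0" by simp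
        with that(3) show False by (simp add: nat_vec_add_eq_0_iff)
      qed
      with XP[OF x] show "x \<in> ?M" by blast
    next
      fix m assume m: "m \<in> ?M"
      then obtain x s where xs: "x \<in> X" "s \<in> S" "m = x + s"
        unfolding PX by (auto simp: set_plus_def)
      with m XP have "s = 0" by blast
      with xs show "m \<in> X" by simp
    qed
  qed
qed

section \<open>Maxima of finite sets\<close>

lemma finite_has_max_wrt:
  assumes "linear_order {(a, b). le a b}" "finite A" "A \<noteq> {}"
  shows "\<exists>m\<in>A. \<forall>a\<in>A. le a m"
  using assms(2,3)
proof (induction rule: finite_ne_induct)
  case (singleton x)
  have "le x x" using assms(1)
    by (auto simp: linear_order_on_def partial_order_on_def preorder_on_def refl_on_def)
  then show ?case by simp
next
  case (insert x A)
  then obtain m where m: "m \<in> A" "\<forall>a\<in>A. le a m" by blast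
  have refl: "le y y" and tr: "le a b \<Longrightarrow> le b c \<Longrightarrow> le a c" for y a b c
    using assms(1) by (auto simp: linear_order_on_def partial_order_on_def preorder_on_def
        refl_on_def dest: transD)
  have tot: "le x m \<or> le m x"
    using assms(1) refl[of x] unfolding linear_order_on_def total_on_def
    by (cases "x = m") auto
  then show ?case
  proof
    assume "le x m"
    with m show ?thesis by auto
  next
    assume "le m x"
    have "le a x" if "a \<in> insert x A" for a
      using that m(2) refl[of x] tr[OF _ \<open>le m x\<close>, of a] by auto
    then show ?thesis by auto
  qed
qed

lemma max_wrt_eqI:
  assumes "linear_order {(a, b). le a b}" "m \<in> A" "\<And>a. a \<in> A \<Longrightarrow> le a m"
  shows "max_wrt le A = m"
  unfolding max_wrt_def
proof (rule the_equality)
  show "m' = m" if "m' \<in> A \<and> (\<forall>a\<in>A. le a m')" for m'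
    using that assms by (auto simp: linear_order_on_def partial_order_on_def antisym_def)
qed (use assms in auto)

lemma max_wrt_props:
  assumes "linear_order {(a, b). le a b}" "finite A" "A \<noteq> {}"
  shows "max_wrt le A \<in> A" "a \<in> A \<Longrightarrow> le a (max_wrt le A)"
proof -
  obtain m where m: "m \<in> A" "\<forall>a\<in>A. le a m"
    using finite_has_max_wrt[OF assms] by blast
  then have "max_wrt le A = m" using assms(1) by (intro max_wrt_eqI) auto
  with m show "max_wrt le A \<in> A" "a \<in> A \<Longrightarrow> le a (max_wrt le A)" by auto
qed

section \<open>Changing a member of \<open>J S\<close> by one element\<close>

text \<open>Any new sum has the form \<open>x + s\<close> with \<open>s\<close> in \<open>S\<close>,
  so it is \<open>x\<close> itself or already in \<open>T\<close> by \<open>step\<close>. This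
  settles closure of the monoid and of the ideal alike.\<close>

lemma J_insertI:
  assumes S: "submonoid S" and T: "T \<in> J S" and x: "x \<in> S" "x \<noteq> 0"
    and step: "\<And>s. s \<in> S \<Longrightarrow> s \<noteq> 0 \<Longrightarrow> x + s \<in> T"
  shows "insert x T \<in> J S"
proof -
  have aT: "affine_semigroup T" and idl: "ideal_of S (T - {0})"
    using T by (auto simp: J_def)
  have T': "submonoid T" using aT by (rule affine_imp_submonoid)
  have TS: "T \<subseteq> S" using idl S by (auto simp: ideal_of_def submonoid_def)
  have step': "x + s \<in> insert x T" if "s \<in> S" for s
    using step[OF that] by (cases "s = 0") auto
  have "submonoid (insert x T)"
    unfolding submonoid_def
  proof (intro conjI ballI)
    show "0 \<in> insert x T" using T' by (simp add: submonoid_def)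
    fix y z assume "y \<in> insert x T" "z \<in> insert x T"
    then show "y + z \<in> insert x T"
      using T' TS x(1) step'[of z] step'[of y] by (auto simp: submonoid_def add.commute)
  qed
  moreover have "ideal_of S (insert x T - {0})"
    unfolding ideal_of_def
  proof (intro conjI subsetI)
    show "insert x T - {0} \<noteq> {}" using x by auto
    show "y \<in> S" if "y \<in> insert x T - {0}" for y using that TS x by auto
    fix z assume "z \<in> (insert x T - {0}) + S"
    then obtain y s where ys: "y \<in> insert x T - {0}" "s \<in> S" "z = y + s"
      by (auto simp: set_plus_def)
    have "z \<in> insert x T"
      using ys step'[of s] ideal_add_mem[OF idl, of y s] by auto
    with ys show "z \<in> insert x T - {0}" by (auto simp: nat_vec_add_eq_0_iff)
  qed
  ultimately show ?thesis
    using affine_semigroup_insert[OF aT] by (simp add: J_def)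
qed

text \<open>A minimal generator is never \<open>y + s\<close> with \<open>y\<close> in the ideal and
  \<open>s\<close> nonzero, so no sum of remaining elements needs it.\<close>

lemma J_removeI:
  assumes S: "submonoid S" and T: "T \<in> J S"
    and x: "x \<in> imsg S (T - {0})"
  shows "T - {x} \<in> J S"
proof -
  have aT: "affine_semigroup T" and idl: "ideal_of S (T - {0})"
    using T by (auto simp: J_def)
  have T': "submonoid T" using aT by (rule affine_imp_submonoid)
  have TS: "T \<subseteq> S" using idl S by (auto simp: ideal_of_def submonoid_def)
  have xT: "x \<in> T" "x \<noteq> 0"
    and xmin: "\<And>y s. y \<in> T \<Longrightarrow> y \<noteq> 0 \<Longrightarrow> s \<in> S \<Longrightarrow> s \<noteq> 0 \<Longrightarrow> x \<noteq> y + s"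
    using x by (auto simp: imsg_eq[OF S idl])
  have add: "y + s \<in> T - {x} - {0}" if "y \<in> T - {x} - {0}" "s \<in> S" for y s
  proof (cases "s = 0")
    case False
    with that show ?thesis using xmin[of y s] ideal_add_mem[OF idl, of y s] by auto
  qed (use that in simp)
  have "submonoid (T - {x})"
    unfolding submonoid_def
  proof (intro conjI ballI)
    show "0 \<in> T - {x}" using T' xT by (simp add: submonoid_def)
    fix y z assume "y \<in> T - {x}" "z \<in> T - {x}"
    then show "y + z \<in> T - {x}"
      using add[of y z] TS by (cases "y = 0") auto
  qed
  moreover have "ideal_of S (T - {x} - {0})"
    unfolding ideal_of_def
  proof (intro conjI)
    \<comment> \<open>Witness that the ideal stays non-empty without \<open>x\<close>.\<close>
    have "x + x \<in> T - {x} - {0}"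
      using xT T' by (auto simp: submonoid_def nat_vec_add_eq_0_iff)
    then show "T - {x} - {0} \<noteq> {}" by blast
    show "T - {x} - {0} + S \<subseteq> T - {x} - {0}"
      using add by (auto simp only: set_plus_def)
  qed (use TS in auto)
  ultimately show ?thesis
    using affine_semigroup_remove[OF aT] xT by (simp add: J_def)
qed

lemma J_self:
  assumes "affine_semigroup S" "S \<noteq> {0}"
  shows "S \<in> J S"
proof -
  have S: "submonoid S" using assms(1) by (rule affine_imp_submonoid)
  then have "ideal_of S (S - {0})"
    using assms(2) unfolding ideal_of_def
    by (auto simp: submonoid_def set_plus_def nat_vec_add_eq_0_iff)
  with assms show ?thesis by (simp add: J_def)
qed

lemma J_subset: "submonoid S \<Longrightarrow> T \<in> J S \<Longrightarrow> T \<subseteq> S"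
  by (auto simp: J_def ideal_of_def submonoid_def)

lemma J_zero_mem: "T \<in> J S \<Longrightarrow> 0 \<in> T"
  by (auto simp: J_def submonoid_def dest: affine_imp_submonoid)

text \<open>The gaps are finitely many, so a largest one exists. Adding a nonzero \<open>s\<close>
  in \<open>S\<close> makes it strictly larger, so the result is no gap and \<open>J_insertI\<close>
  applies.\<close>

lemma
  assumes "monomial_order le" "affine_semigroup S" "T \<in> J S" "T \<noteq> S"
  shows Omax_mem: "Omax le S T \<in> S - T"
    and Omax_greatest: "\<And>y. y \<in> S - T \<Longrightarrow> le y (Omax le S T)"
    and insert_Omax_J: "insert (Omax le S T) T \<in> J S"
proof -
  have lin: "linear_order {(a, b). le a b}"
    and mono: "\<And>a b c. le a b \<Longrightarrow> le (a + c) (b + c)" and pos: "\<And>c. le 0 c"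
    using assms(1) by (auto simp: monomial_order_def)
  have S: "submonoid S" using assms(2) by (rule affine_imp_submonoid)
  have ne: "S - T \<noteq> {}" using J_subset[OF S assms(3)] assms(4) by auto
  note max = max_wrt_props[OF lin finite_complement_J[OF assms(2,3)] ne, folded Omax_def]
  show mem: "Omax le S T \<in> S - T" by (rule max(1))
  show gr: "le y (Omax le S T)" if "y \<in> S - T" for y using that by (rule max(2))
  show "insert (Omax le S T) T \<in> J S"
  proof (rule J_insertI[OF S assms(3)])
    show "Omax le S T \<in> S" "Omax le S T \<noteq> 0" using mem J_zero_mem[OF assms(3)] by auto
    fix s assume s: "s \<in> S" "s \<noteq> 0"
    show "Omax le S T + s \<in> T"
    proof (rule ccontr)
      assume "Omax le S T + s \<notin> T"
      with mem s S have "le (Omax le S T + s) (Omax le S T)"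
        by (intro gr) (auto simp: submonoid_def)
      moreover have "le (Omax le S T) (Omax le S T + s)"
        using mono[OF pos[of s], of "Omax le S T"] by (simp add: add.commute)
      ultimately have "Omax le S T + s = Omax le S T"
        using lin unfolding linear_order_on_def partial_order_on_def antisym_def by blast
      with s show False by simp
    qed
  qed
qed

section \<open>Children and the tree\<close>

text \<open>A child of \<open>T\<close> arises by removing some \<open>x\<close>, and its gaps are
  those of \<open>T\<close> together with \<open>x\<close>. So \<open>x\<close> is the largest gap
  of the child exactly when it exceeds all gaps of \<open>T\<close>.\<close>

lemma children_G_J:
  assumes "monomial_order le" "affine_semigroup S" "T \<in> J S"
  shows "children (G_J le S) T =
      {T - {x} | x. x \<in> imsg S (T - {0}) \<and>
        (T = S \<or> (le (Omax le S T) x \<and> x \<noteq> Omax le S T))}" (is "_ = ?R")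
proof -
  have lin: "linear_order {(a, b). le a b}"
    using assms(1) by (simp add: monomial_order_def)
  have refl: "le y y" and tr: "le a b \<Longrightarrow> le b c \<Longrightarrow> le a c" for y a b c
    using lin by (auto simp: linear_order_on_def partial_order_on_def preorder_on_def
        refl_on_def dest: transD)
  have S: "submonoid S" using assms(2) by (rule affine_imp_submonoid)
  have idl: "ideal_of S (T - {0})" using assms(3) by (simp add: J_def)
  have "children (G_J le S) T = {T1 \<in> J S. T1 \<noteq> S \<and> T = insert (Omax le S T1) T1}"
    using assms(3) by (auto simp: children_def G_J_def)
  also have "\<dots> = ?R"
  proof (intro equalityI subsetI)
    fix T1 assume "T1 \<in> {T1 \<in> J S. T1 \<noteq> S \<and> T = insert (Omax le S T1) T1}"
    then have T1: "T1 \<in> J S" "T1 \<noteq> S" and T: "T = insert (Omax le S T1) T1" by auto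
    define x where "x = Omax le S T1"
    have x: "x \<in> S" "x \<notin> T1" "\<And>y. y \<in> S - T1 \<Longrightarrow> le y x"
      using Omax_mem[OF assms(1,2) T1] Omax_greatest[OF assms(1,2) T1] by (auto simp: x_def)
    have idl1: "ideal_of S (T1 - {0})" using T1 by (simp add: J_def)
    have "x \<noteq> y + s" if "y \<in> T - {0}" "s \<in> S - {0}" for y s
    proof
      assume eq: "x = y + s"
      \<comment> \<open>Here \<open>y \<noteq> x\<close> because \<open>s\<close> is nonzero; the
        ideal of \<open>T1\<close> would then contain \<open>x\<close>.\<close>
      with that have "y \<in> T1 - {0}" by (auto simp: T x_def)
      with that eq x(2) show False using ideal_add_mem[OF idl1, of y s] by auto
    qed
    moreover have "x \<in> T - {0}" using x(2) J_zero_mem[OF T1(1)] by (auto simp: T x_def)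
    ultimately have "x \<in> imsg S (T - {0})" by (auto simp: imsg_eq[OF S idl])
    moreover have "T1 = T - {x}" using x(2) by (auto simp: T x_def)
    \<comment> \<open>The largest gap of \<open>T\<close> is also a gap of \<open>T1\<close>, and it
      differs from \<open>x\<close> because \<open>x\<close> is in \<open>T\<close>.\<close>
    moreover have "le (Omax le S T) x \<and> x \<noteq> Omax le S T" if "T \<noteq> S"
      using Omax_mem[OF assms that] x(3) by (auto simp: T x_def)
    ultimately show "T1 \<in> ?R" by blast
  next
    fix T1 assume "T1 \<in> ?R"
    then obtain x where T1: "T1 = T - {x}" and x: "x \<in> imsg S (T - {0})"
      and gt: "T \<noteq> S \<Longrightarrow> le (Omax le S T) x" by blast
    have xT: "x \<in> T" using x by (auto simp: imsg_eq[OF S idl])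
    then have xS: "x \<in> S" using J_subset[OF S assms(3)] by auto
    have "Omax le S T1 = x"
      unfolding Omax_def
    proof (rule max_wrt_eqI[OF lin])
      show "x \<in> S - T1" using xS T1 by auto
      fix a assume a: "a \<in> S - T1"
      show "le a x"
      proof (cases "a = x")
        case False
        with a have "a \<in> S - T" by (auto simp: T1)
        then have "T \<noteq> S" by auto
        from tr[OF Omax_greatest[OF assms this \<open>a \<in> S - T\<close>] gt[OF this]] show ?thesis .
      qed (simp add: refl)
    qed
    moreover have "T1 \<in> J S" unfolding T1 using S assms(3) x by (rule J_removeI)
    ultimately show "T1 \<in> {T1 \<in> J S. T1 \<noteq> S \<and> T = insert (Omax le S T1) T1}"
      using xT xS by (auto simp: T1)
  qed
  finally show ?thesis .
qed

text \<open>Uniqueness is shown for all directed walks by induction on the number of gaps, and then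
  carried over to trails.\<close>

lemma tree_G_J:
  assumes "monomial_order le" "affine_semigroup S" "S \<noteq> {0}"
  shows "tree_with_root (G_J le S) S"
proof -
  let ?G = "G_J le S"
  interpret wf_digraph ?G by unfold_locales (auto simp: G_J_def)
  have SJ: "S \<in> J S" using assms(2,3) by (rule J_self)
  have ex1: "\<exists>!p. awalk T p S" if "T \<in> J S" for T
    using that
  proof (induction "card (S - T)" arbitrary: T rule: less_induct)
    case less
    show ?case
    proof (cases "T = S")
      case True
      \<comment> \<open>No arc leaves \<open>S\<close>, so only the empty walk remains.\<close>
      have "p = []" if "awalk S p S" for p
      proof (rule ccontr)
        assume "p \<noteq> []"
        then obtain e q where "p = e # q" by (cases p) auto
        with that have "e \<in> arcs ?G" "S = tail ?G e" by (simp_all add: awalk_Cons_iff)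
        then show False by (auto simp: G_J_def)
      qed
      moreover have "awalk S [] S" unfolding awalk_Nil_iff using SJ by (simp add: G_J_def)
      ultimately show ?thesis unfolding True by blast
    next
      case False
      let ?T = "insert (Omax le S T) T"
      note O = Omax_mem[OF assms(1,2) less.prems False] insert_Omax_J[OF assms(1,2) less.prems False]
      have "card (S - ?T) < card (S - T)"
        using O finite_complement_J[OF assms(2) less.prems]
        by (intro psubset_card_mono) auto
      from less.hyps[OF this O(2)] obtain p where p: "awalk ?T p S"
        and uniq: "\<And>q. awalk ?T q S \<Longrightarrow> q = p" by blast
      show ?thesis
      proof (rule ex1I)
        show "awalk T ((T, ?T) # p) S"
          unfolding awalk_Cons_iff
          using p O(2) less.prems False by (simp add: G_J_def)
        fix q assume q: "awalk T q S"
        with False obtain e q' where "q = e # q'" by (cases q) (auto simp: awalk_Nil_iff)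
        with q have "e \<in> arcs ?G" "T = tail ?G e" and q': "awalk (head ?G e) q' S"
          by (simp_all add: awalk_Cons_iff)
        then have "e = (T, ?T)" "head ?G e = ?T" by (auto simp: G_J_def)
        with uniq q' \<open>q = e # q'\<close> show "q = (T, ?T) # p" by simp
      qed
    qed
  qed
  \<comment> \<open>Cutting the cycles out of a walk gives one without repeated vertices, hence
    without repeated arcs; this yields existence. Uniqueness is inherited, as trails are
    walks.\<close>
  have "\<exists>!p. trail T p S" if T: "T \<in> J S" for T
  proof -
    obtain p where p: "awalk T p S" "\<And>q. awalk T q S \<Longrightarrow> q = p" using ex1[OF T] by blast
    have "apath T (awalk_to_apath p) S" using p(1) by (rule apath_awalk_to_apath)
    then have "trail T (awalk_to_apath p) S"
      by (auto simp: trail_def apath_def intro: distinct_verts_imp_distinct)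
    with p(2) show ?thesis by (auto simp: trail_def)
  qed
  then show ?thesis
    using SJ wf_digraph_axioms by (simp add: tree_with_root_def G_J_def)
qed

theorem theorem11:
  fixes le :: "nat ^ 'p \<Rightarrow> nat ^ 'p \<Rightarrow> bool"
    and S :: "(nat ^ 'p) set"
  assumes "monomial_order le"
    and "C_semigroup S"
    and "S \<noteq> {0}"
  shows "tree_with_root (G_J le S) S \<and>
    (\<forall>T\<in>J S. children (G_J le S) T =
      {T - {x} | x. x \<in> imsg S (T - {0}) \<and>
        (T = S \<or> (le (Omax le S T) x \<and> x \<noteq> Omax le S T))})"
proof -
  have "affine_semigroup S" using assms(2) by (simp add: C_semigroup_def)
  then show ?thesis using tree_G_J children_G_J assms(1,3) by blast
qed

end
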